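(* Consider the Diophantine equation $$k \cdot \prod_{j=1}^{r} (x_{j}-1) = \prod_{j=1}^{r} x_{j} - 1, \qquad k \in \mathbb{Z}_{>0},\ x_{j} \in \mathbb{Z}_{\geq 2} \text{ for } 1 \leq j \leq r.$$ As $r$ ranges over the integers with $2 \leq r \leq 6$, and counting solutions $(k; x_1, \dots, x_r)$ up to permutation of $x_1, \dots, x_r$ (that is, regarding $\{x_1, \dots, x_r\}$ as a multiset), this equation has a total of $76$ solutions: $31$ in which all of $x_1, \dots, x_r$ are odd (and $\geq 3$), and $45$ in which all of $x_1, \dots, x_r$ are even (and $\geq 2$). *)

theory Defs
  imports Main "HOL-Library.Multiset"
begin

(* A solution (k; x_1, ..., x_r) up to permutation of the x_j is a pair of k and a multiset of
   size r.  Everything lives in int, so that no subtraction truncates. *)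
definition solutions :: "nat \<Rightarrow> (int \<times> int multiset) set" where
  "solutions r = {(k, X). k > 0 \<and> size X = r \<and> (\<forall>x\<in>#X. x \<ge> 2) \<and>
     k * (\<Prod>x\<in>#X. x - 1) = (\<Prod>x\<in>#X. x) - 1}"

end

theory Submission
  imports Defs
begin

text \<open>
  Write \<open>Y = x\<^sub>1 \<cdots> x\<^sub>r\<close> and \<open>Z = (x\<^sub>1 - 1) \<cdots> (x\<^sub>r - 1)\<close>, so that the equation is \<open>k Z = Y - 1\<close>. If some
  \<open>x\<^sub>j\<close> is odd, then \<open>Z\<close> is even, hence \<open>Y\<close> is odd and so is every \<open>x\<^sub>i\<close>
  (\<open>all_odd_or_all_even\<close>). The solutions therefore split into two parity classes, and in each of them
  the count is a finite search, made possible by the following facts.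

  Fix the smallest entries \<open>x\<^sub>1 \<le> \<dots> \<le> x\<^sub>i\<close> of a solution and put \<open>a = k (x\<^sub>1 - 1) \<cdots> (x\<^sub>i - 1)\<close> and
  \<open>b = x\<^sub>1 \<cdots> x\<^sub>i\<close>. The remaining entries solve \<open>a Z' = b Y' - 1\<close>, an equation of the same shape.
  Since \<open>Y'\<close> exceeds \<open>Z'\<close> by at least the number of these entries, this forces \<open>b < a\<close>
  (\<open>completions_imp_less\<close>), and clearly \<open>a\<close> and \<open>b\<close> are coprime. As \<open>b < a\<close>, the ratio \<open>Y' / Z'\<close> must exceed \<open>a / b > 1\<close>, so the next entry cannot be
  large; Bernoulli's inequality gives \<open>x \<le> a n / (a - b)\<close> with \<open>n\<close> entries to go
  (\<open>completions_hd_bound\<close>).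

  Choosing the last two entries \<open>x \<le> y\<close> in the same way would be slow, because they can be huge. With
  \<open>d = a - b\<close>, however, their equation becomes \<open>(d x - a) (d y - a) = a b - d\<close>, so they come from the
  factorizations of one known number into two factors from a fixed residue class. These are
  enumerated by letting the smaller factor run through its residue class while the quotient and the
  remainder are updated instead of recomputed (\<open>set_scan\<close>), which keeps the evaluation by rewriting
  short.

  The longest of these scans belongs to \<open>k = 2\<close> and the prefix \<open>3, 5, 17, 257\<close> of Fermat numbers. There
  \<open>a = 2\<^sup>1\<^sup>6\<close> and \<open>b = 2\<^sup>1\<^sup>6 - 1\<close>, so that \<open>d = 1\<close> and every odd number below \<open>2\<^sup>1\<^sup>6\<close> is a candidate.
\<close>

section \<open>Completing a sorted prefix to a solution\<close>

lemma le_zdiv_iff_mult_le: "n \<le> m div q \<longleftrightarrow> n * q \<le> m" if "0 < q" for m n q :: int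
proof
  assume "n \<le> m div q"
  then have "n * q \<le> (m div q) * q" using that by (intro mult_right_mono) auto
  also have "\<dots> \<le> m" using that pos_mod_sign[of q m] div_mult_mod_eq[of m q] by linarith
  finally show "n * q \<le> m" .
next
  assume "n * q \<le> m"
  from zdiv_mono1[OF this that] show "n \<le> m div q" using that by simp
qed

text \<open>
  With \<open>a = k\<close> and \<open>b = 1\<close> these are the sorted solutions of length \<open>n\<close> whose entries are at least
  \<open>lo\<close> and have the parity of \<open>lo\<close>; with other \<open>a\<close> and \<open>b\<close>, the tails of such solutions. Lists in
  sorted order represent multisets uniquely.
\<close>

definition completions :: "nat \<Rightarrow> int \<Rightarrow> int \<Rightarrow> int \<Rightarrow> int list set" where
  "completions n a b lo = {xs. length xs = n \<and> sorted xs \<and> (\<forall>x\<in>set xs. lo \<le> x \<and> even (x - lo)) \<and>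
     a * (\<Prod>x\<leftarrow>xs. x - 1) = b * (\<Prod>x\<leftarrow>xs. x) - 1}"

text \<open>
  Expanding the product of the numbers \<open>(x - 1) + 1\<close> gives the product of the \<open>x - 1\<close> and, for each
  position, at least one further positive term. The bound by the length, rather than by \<open>1\<close>, is
  what rules out \<open>k = 1\<close> for two or more entries.
\<close>

lemma prod_pred_plus_length_le_prod:
  fixes xs :: "int list"
  assumes "\<forall>x\<in>set xs. 2 \<le> x"
  shows "1 \<le> (\<Prod>x\<leftarrow>xs. x - 1) \<and> (\<Prod>x\<leftarrow>xs. x - 1) + int (length xs) \<le> (\<Prod>x\<leftarrow>xs. x)"
  using assms
proof (induction xs)
  case (Cons x xs)
  define Y Z n where "Y = (\<Prod>x\<leftarrow>xs. x)" and "Z = (\<Prod>x\<leftarrow>xs. x - 1)" and "n = int (length xs)"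
  have IH: "1 \<le> Z" "Z + n \<le> Y" and x: "2 \<le> x" and n: "0 \<le> n"
    using Cons unfolding Y_def Z_def n_def by auto
  have "x * (Z + n) \<le> x * Y" using IH(2) x by (simp add: mult_left_mono)
  moreover have "1 * n \<le> x * n" using x n by (intro mult_right_mono) auto
  moreover have "1 * 1 \<le> (x - 1) * Z" using x IH(1) by (intro mult_mono) auto
  ultimately have "1 \<le> (x - 1) * Z \<and> (x - 1) * Z + (n + 1) \<le> x * Y"
    using IH(1) by (simp add: algebra_simps)
  then show ?case by (simp add: Y_def Z_def n_def algebra_simps)
qed simp

text \<open>
  If \<open>a \<le> b\<close>, then \<open>1 = b Y - a Z \<ge> b (Y - Z) \<ge> b n\<close>.
\<close>

lemma completions_imp_less:
  assumes "xs \<in> completions n a b lo" "2 \<le> lo" "1 < b * int n" "1 \<le> b"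
  shows "b < a"
proof (rule ccontr)
  assume "\<not> b < a"
  define Y Z where "Y = (\<Prod>x\<leftarrow>xs. x)" and "Z = (\<Prod>x\<leftarrow>xs. x - 1)"
  have eq: "a * Z = b * Y - 1" and "1 \<le> Z" "Z + int n \<le> Y"
    using assms(1,2) prod_pred_plus_length_le_prod[of xs]
    by (force simp: completions_def Y_def Z_def)+
  have "a * Z \<le> b * Z" using \<open>\<not> b < a\<close> \<open>1 \<le> Z\<close> by (intro mult_right_mono) auto
  moreover have "b * (Z + int n) \<le> b * Y" using \<open>Z + int n \<le> Y\<close> assms(4) by (intro mult_left_mono) auto
  ultimately show False using eq assms(3) by (simp add: algebra_simps)
qed

lemma completions_imp_coprime:
  assumes "xs \<in> completions n a b lo"
  shows "gcd a b = 1"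
proof -
  have "1 = b * (\<Prod>x\<leftarrow>xs. x) - a * (\<Prod>x\<leftarrow>xs. x - 1)" using assms by (simp add: completions_def)
  moreover have "gcd a b dvd b * (\<Prod>x\<leftarrow>xs. x) - a * (\<Prod>x\<leftarrow>xs. x - 1)" by (intro dvd_diff) auto
  ultimately have "gcd a b dvd 1" by simp
  then show ?thesis by simp
qed

text \<open>
  This is \<open>1 - n / x \<le> (1 - 1 / y\<^sub>1) \<cdots> (1 - 1 / y\<^sub>n)\<close> without denominators.
\<close>

lemma bernoulli_prod_pred:
  fixes xs :: "int list"
  assumes "1 \<le> x" "\<forall>y\<in>set xs. x \<le> y"
  shows "(x - int (length xs)) * (\<Prod>y\<leftarrow>xs. y) \<le> x * (\<Prod>y\<leftarrow>xs. y - 1)"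
  using assms(2)
proof (induction xs)
  case (Cons y ys)
  define Y Z n where "Y = (\<Prod>x\<leftarrow>ys. x)" and "Z = (\<Prod>x\<leftarrow>ys. x - 1)" and "n = int (length ys)"
  have IH: "(x - n) * Y \<le> x * Z" and xy: "x \<le> y" and n: "0 \<le> n"
    using Cons unfolding Y_def Z_def n_def by auto
  have Y: "0 \<le> Y" unfolding Y_def using Cons.prems assms(1)
    by (intro prod_list_nonneg) force
  have "0 \<le> (y - (x - n)) * Y" using Y xy n by simp
  moreover have "(y - 1) * ((x - n) * Y) \<le> (y - 1) * (x * Z)"
    using IH xy assms(1) by (intro mult_left_mono) auto
  ultimately have "(x - (n + 1)) * (y * Y) \<le> x * ((y - 1) * Z)" by (simp add: algebra_simps)
  then show ?case by (simp add: Y_def Z_def n_def algebra_simps)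
qed simp

lemma completions_hd_bound:
  assumes "x # xs \<in> completions n a b lo" "2 \<le> lo" "0 < b" "b < a"
  shows "x \<le> a * int n div (a - b)"
proof -
  define Y Z where "Y = (\<Prod>y\<leftarrow>x # xs. y)" and "Z = (\<Prod>y\<leftarrow>x # xs. y - 1)"
  have eq: "a * Z = b * Y - 1" and len: "length (x # xs) = n" and x: "2 \<le> x"
    and ge: "\<forall>y\<in>set (x # xs). x \<le> y"
    using assms(1,2) by (force simp: completions_def Y_def Z_def)+
  have ge2: "\<forall>y\<in>set (x # xs). 2 \<le> y" using ge x by force
  have Y: "0 < Y" using prod_pred_plus_length_le_prod[OF ge2] by (simp add: Y_def)
  have "(x - int n) * Y \<le> x * Z"
    using bernoulli_prod_pred[OF _ ge] x len unfolding Y_def Z_def by fastforce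
  then have "a * ((x - int n) * Y) \<le> a * (x * Z)" using assms by (intro mult_left_mono) auto
  also have "\<dots> = x * (b * Y - 1)" by (simp add: mult.left_commute flip: eq)
  also have "\<dots> < x * (b * Y)" using x by simp
  finally have "(a * (x - int n)) * Y < (x * b) * Y" by (simp add: algebra_simps)
  then have "a * (x - int n) < x * b" using Y by (simp add: mult_less_cancel_right)
  then have "x * (a - b) \<le> a * int n" by (simp add: algebra_simps)
  then show ?thesis using assms by (simp add: le_zdiv_iff_mult_le)
qed

lemma prod_pred_ratio_bound:
  fixes xs :: "int list"
  assumes "2 \<le> lo" "\<forall>x\<in>set xs. lo \<le> x"
  shows "(lo - 1) ^ length xs * (\<Prod>x\<leftarrow>xs. x) \<le> lo ^ length xs * (\<Prod>x\<leftarrow>xs. x - 1)"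
  using assms(2)
proof (induction xs)
  case (Cons x xs)
  define Y Z where "Y = (\<Prod>x\<leftarrow>xs. x)" and "Z = (\<Prod>x\<leftarrow>xs. x - 1)"
  have Y: "0 \<le> Y" unfolding Y_def using Cons.prems assms(1)
    by (intro prod_list_nonneg) force
  have IH: "(lo - 1) ^ length xs * Y \<le> lo ^ length xs * Z" and x: "lo \<le> x"
    using Cons unfolding Y_def Z_def by auto
  have "(lo - 1) * x \<le> lo * (x - 1)" using x by (simp add: algebra_simps)
  then have "((lo - 1) * x) * ((lo - 1) ^ length xs * Y) \<le> (lo * (x - 1)) * (lo ^ length xs * Z)"
    by (rule mult_mono) (use IH assms(1) x Y in auto)
  then show ?case by (simp add: Y_def Z_def algebra_simps)
qed simp

text \<open>
  The analogue of the bound on the next entry for the very first choice, that of \<open>k\<close>, which is less than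
  \<open>Y / Z\<close> and hence less than \<open>(lo / (lo - 1))\<^sup>n\<close>.
\<close>

lemma completions_multiplier_bound:
  assumes "xs \<in> completions n k 1 lo" "2 \<le> lo" "0 \<le> k"
  shows "k \<le> lo ^ n div (lo - 1) ^ n"
proof -
  define Y Z where "Y = (\<Prod>x\<leftarrow>xs. x)" and "Z = (\<Prod>x\<leftarrow>xs. x - 1)"
  have eq: "k * Z = Y - 1" and len: "length xs = n"
    and ge: "\<forall>y\<in>set xs. lo \<le> y"
    using assms(1) by (force simp: completions_def Y_def Z_def)+
  have "\<forall>y\<in>set xs. 2 \<le> y" using ge assms(2) by force
  then have Y: "0 < Y" using prod_pred_plus_length_le_prod[of xs] by (simp add: Y_def)
  have "k * ((lo - 1) ^ n * Y) \<le> k * (lo ^ n * Z)"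
    using prod_pred_ratio_bound[OF assms(2) ge] assms(3) len
    by (intro mult_left_mono) (auto simp: Y_def Z_def)
  also have "\<dots> = lo ^ n * (Y - 1)" by (simp add: mult.left_commute flip: eq)
  also have "\<dots> < lo ^ n * Y" using assms(2) by simp
  finally have "(k * (lo - 1) ^ n) * Y < lo ^ n * Y" by (simp add: algebra_simps)
  then have "k * (lo - 1) ^ n < lo ^ n" using Y by (simp add: mult_less_cancel_right)
  then show ?thesis using assms(2) by (simp add: le_zdiv_iff_mult_le)
qed

lemma Cons_in_completions_iff:
  "x # xs \<in> completions (Suc n) a b lo \<longleftrightarrow>
     lo \<le> x \<and> even (x - lo) \<and> xs \<in> completions n (a * (x - 1)) (b * x) x"
proof -
  have "even (y - x) \<longleftrightarrow> even (y - lo)" if "even (x - lo)" for y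
    using that by simp
  then show ?thesis by (fastforce simp: completions_def algebra_simps)
qed

section \<open>The last two entries\<close>

text \<open>
  Invariant: the number to be factored is \<open>f * g + d * r\<close> with \<open>0 \<le> r < f\<close>, so \<open>f\<close> has a cofactor
  in the residue class of \<open>g\<close> modulo \<open>d\<close> if and only if \<open>r = 0\<close>. Passing to \<open>f' = f + 2 * d\<close> changes
  the defect \<open>d * r\<close> by \<open>- 2 * d * g\<close>, and a division by \<open>f'\<close>, whose quotient is only about
  \<open>- 2 * g / f'\<close>, restores the range of the remainder. The step is \<open>2 * d\<close> because the entry \<open>x\<close> behind \<open>f = d * x - a\<close> keeps its
  parity.
\<close>

partial_function (tailrec) scan ::
    "int \<Rightarrow> int \<Rightarrow> int \<Rightarrow> int \<Rightarrow> (int \<times> int) list \<Rightarrow> (int \<times> int) list" where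
  [code]: "scan d f g r acc = (if g < f then acc else
     let f' = f + 2 * d; u = r - 2 * g; t = u div f'
     in scan d f' (g + d * t) (u - f' * t) (if r = 0 then (f, g) # acc else acc))"

text \<open>
  The scan may stop at the first \<open>f\<close> above \<open>g\<close>: both lie in the same class modulo \<open>d\<close>, so \<open>g \<le> f - d\<close>
  and the number to be factored is at most \<open>f * (f - d) + d * r < f * f\<close>.
\<close>

lemma set_scan:
  assumes "0 < d" "0 < f" "0 \<le> r" "r < f" "d dvd g - f"
  shows "set (scan d f g r acc) = set acc \<union>
    {(F, G). f \<le> F \<and> F \<le> G \<and> 2 * d dvd F - f \<and> d dvd G - F \<and> F * G = f * g + d * r}"
  using assms
proof (induction "nat (g - f + 1)" arbitrary: f g r acc rule: less_induct)
  case less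
  show ?case
  proof (cases "g < f")
    case True
    have "F * G \<noteq> f * g + d * r" if "f \<le> F" "F \<le> G" for F G
    proof -
      obtain i where i: "g - f = d * i" using less.prems by blast
      have "i < 0" using True i \<open>0 < d\<close> by (smt (verit) mult_nonneg_nonneg)
      then have "d * i \<le> d * (-1)" using \<open>0 < d\<close> by (intro mult_left_mono) auto
      then have "f * (g + d) \<le> f * f" using i less.prems by (intro mult_left_mono) auto
      moreover have "f * f \<le> F * G" using that less.prems by (intro mult_mono) auto
      moreover have "d * r < d * f" using less.prems by simp
      ultimately show ?thesis by (simp add: algebra_simps)
    qed
    then show ?thesis using True by (subst scan.simps) auto
  next
    case False
    define f' where "f' = f + 2 * d"
    define u where "u = r - 2 * g"
    define t where "t = u div f'"
    define acc' where "acc' = (if r = 0 then (f, g) # acc else acc)"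
    have rec: "scan d f g r acc = scan d f' (g + d * t) (u - f' * t) acc'"
      using False by (subst scan.simps) (simp add: Let_def f'_def u_def t_def acc'_def)
    have f': "f' > 0" "f < f'" using less.prems by (auto simp: f'_def)
    have mod: "u - f' * t = u mod f'" by (simp add: t_def minus_mult_div_eq_mod)
    have "u < 0" using less.prems False by (simp add: u_def)
    then have "t < 0" using f' by (simp add: t_def pos_imp_zdiv_neg_iff)
    then have dt: "d * t < 0" using less.prems by (simp add: mult_pos_neg)
    have "d dvd g + d * t - f'" 
      using dvd_add[OF \<open>d dvd g - f\<close>, of "d * (t - 2)"] by (simp add: f'_def algebra_simps)
    moreover have inv: "f' * (g + d * t) + d * (u - f' * t) = f * g + d * r"
      by (simp add: f'_def u_def algebra_simps)
    moreover have "nat (g + d * t - f' + 1) < nat (g - f + 1)"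
      using dt f' False by linarith
    ultimately have IH: "set (scan d f' (g + d * t) (u - f' * t) acc') = set acc' \<union>
      {(F, G). f' \<le> F \<and> F \<le> G \<and> 2 * d dvd F - f' \<and> d dvd G - F \<and> F * G = f * g + d * r}"
      using less.hyps[of "g + d * t" f' "u - f' * t" acc'] less.prems f' mod by simp
    \<comment> \<open>At the current \<open>f\<close>, two cofactors in the class of \<open>g\<close> would differ by a nonzero multiple of
      \<open>d\<close>, which changes the product by at least \<open>d * f\<close>, more than the defect \<open>d * r\<close>.\<close>
    have at_f: "G = g \<and> r = 0" if "f * G = f * g + d * r" "d dvd G - f" for G
    proof -
      have "d dvd (G - f) - (g - f)" using that(2) less.prems(5) by (rule dvd_diff)
      then obtain i where i: "G = g + d * i" by (auto simp: dvd_def algebra_simps)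
      then have "d * (f * i) = d * r" using that(1) by (simp add: algebra_simps)
      then have "f * i = r" using less.prems by simp
      then have "i = 0" using less.prems
        by (metis less_irrefl nonzero_mult_div_cancel_left div_pos_pos_trivial)
      then show ?thesis using i \<open>f * i = r\<close> by simp
    qed
    have step: "f \<le> F \<and> 2 * d dvd F - f \<longleftrightarrow> F = f \<or> f' \<le> F \<and> 2 * d dvd F - f'" for F
    proof -
      have "2 * d dvd F - f' \<longleftrightarrow> 2 * d dvd F - f"
        using dvd_add_right_iff[of "2 * d" "- (2 * d)" "F - f"] by (simp add: f'_def algebra_simps)
      moreover have "f' \<le> F" if "2 * d dvd F - f" "f \<le> F" "F \<noteq> f"
        using zdvd_imp_le[OF that(1)] that by (simp add: f'_def)
      ultimately show ?thesis using f' by auto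
    qed
    define P where "P F G \<longleftrightarrow> F \<le> G \<and> d dvd G - F \<and> F * G = f * g + d * r" for F G
    have P_f: "P f G \<longleftrightarrow> G = g \<and> r = 0" for G
      using at_f[of G] False less.prems by (auto simp: P_def)
    have "{(F, G). (f \<le> F \<and> 2 * d dvd F - f) \<and> P F G} =
        {(F, G). F = f \<and> P F G} \<union> {(F, G). (f' \<le> F \<and> 2 * d dvd F - f') \<and> P F G}"
      unfolding step by blast
    moreover have "set acc' = set acc \<union> {(F, G). F = f \<and> P F G}"
      by (auto simp: acc'_def P_f)
    ultimately show ?thesis unfolding rec IH by (simp only: P_def conj_ac Un_assoc)
  qed
qed

text \<open>
  Here \<open>x\<close> is the least candidate of the right parity with \<open>a < d * x\<close>; for it, the equation would
  need \<open>y = n / f\<close>. The integer quotient and remainder of this division start the scan. Its step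
  takes care of the parity of the smaller entry only; that of the larger one is checked afterwards.
\<close>

definition last_pairs :: "int \<Rightarrow> int \<Rightarrow> int \<Rightarrow> int list list" where
  "last_pairs a b lo =
     (let d = a - b; m = max lo (a div d + 1); x = m + (m - lo) mod 2; f = d * x - a;
          n = a * (x - 1) - 1; y = n div f
      in map (\<lambda>(F, G). [(F + a) div d, (G + a) div d])
           (filter (\<lambda>(F, G). even ((G + a) div d - lo)) (scan d f (d * y - a) (n - f * y) [])))"

lemma set_last_pairs:
  assumes "1 \<le> b" "b < a" "2 \<le> lo"
  shows "set (last_pairs a b lo) = completions 2 a b lo"
proof -
  define d where "d = a - b"
  define m where "m = max lo (a div d + 1)"
  define x where "x = m + (m - lo) mod 2"
  define f where "f = d * x - a"
  define n where "n = a * (x - 1) - 1"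
  define y where "y = n div f"
  define g where "g = d * y - a"
  define r where "r = n - f * y"
  have d: "0 < d" using assms by (simp add: d_def)
  have above: "a < d * X \<longleftrightarrow> a div d + 1 \<le> X" for X
    using le_zdiv_iff_mult_le[OF d, of X a] by (auto simp: mult.commute not_le[symmetric])
  have xlo: "even (x - lo)" 
    unfolding x_def by (metis add_diff_eq diff_add_eq even_add mod2_eq_if odd_one even_zero mod_0_imp_dvd dvd_refl)
  have mx: "m \<le> x" "x \<le> m + 1" by (simp_all add: x_def) 
  have f: "0 < f" using above[of x] mx by (simp add: f_def m_def)
  have r: "0 \<le> r" "r < f" using f by (simp_all add: r_def y_def minus_mult_div_eq_mod)
  have gf: "d dvd g - f" by (simp add: g_def f_def flip: right_diff_distrib)
  have N: "f * g + d * r = a * b - d" by (simp add: r_def n_def g_def f_def d_def algebra_simps)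
  have eq_iff: "a * ((X - 1) * (Y - 1)) = b * (X * Y) - 1 \<longleftrightarrow> (d * X - a) * (d * Y - a) = f * g + d * r" for X Y
  proof -
    have "(d * X - a) * (d * Y - a) - (f * g + d * r) = d * (a * ((X - 1) * (Y - 1)) - (b * (X * Y) - 1))"
      unfolding N by (simp add: d_def algebra_simps)
    then show ?thesis using d by (metis eq_iff_diff_eq_0 mult_eq_0_iff less_irrefl)
  qed
  have start: "lo \<le> X \<and> even (X - lo) \<and> a < d * X \<longleftrightarrow> x \<le> X \<and> even (X - x)" for X
  proof -
    have "even (X - lo) \<longleftrightarrow> even (X - x)" using xlo by auto
    moreover have "x \<le> X \<longleftrightarrow> m \<le> X" if "even (X - x)"
    proof -
      have "x = m \<or> X \<noteq> m" using that mx by (cases "x = m") (auto simp: x_def)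
      then show ?thesis using mx by auto
    qed
    ultimately show ?thesis by (auto simp: above m_def)
  qed
  have pos: "a < d * X" if "2 \<le> X" "2 \<le> Y" "a * ((X - 1) * (Y - 1)) = b * (X * Y) - 1" for X Y
  proof -
    have "Y * (d * X - a) = a * (X - 1) - 1" using that(3) by (simp add: d_def algebra_simps)
    moreover have "2 * 1 \<le> a * (X - 1)" using that assms by (intro mult_mono) auto
    ultimately have "0 < Y * (d * X - a)" by linarith
    then show ?thesis using that(2) by (simp add: zero_less_mult_iff)
  qed
  have split: "xs \<in> completions 2 a b lo \<longleftrightarrow> (\<exists>X Y. xs = [X, Y] \<and> x \<le> X \<and> even (X - x) \<and> X \<le> Y \<and>
     even (Y - lo) \<and> (d * X - a) * (d * Y - a) = f * g + d * r)" (is "_ \<longleftrightarrow> ?R") for xs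
  proof
    assume "xs \<in> completions 2 a b lo"
    then obtain X Y where XY: "xs = [X, Y]" "lo \<le> X" "even (X - lo)" "X \<le> Y" "even (Y - lo)"
      "a * ((X - 1) * (Y - 1)) = b * (X * Y) - 1"
      by (auto simp: completions_def numeral_2_eq_2 length_Suc_conv)
    then have "a < d * X" using assms by (intro pos) auto
    then show ?R using XY start[of X] eq_iff by blast
  next
    assume ?R
    then obtain X Y where XY: "xs = [X, Y]" "x \<le> X" "even (X - x)" "X \<le> Y" "even (Y - lo)"
      "(d * X - a) * (d * Y - a) = f * g + d * r" by blast
    then show "xs \<in> completions 2 a b lo"
      using start[of X] eq_iff[of X Y] by (auto simp: completions_def)
  qed
  have scan: "set (scan d f g r []) =
    {(F, G). f \<le> F \<and> F \<le> G \<and> 2 * d dvd F - f \<and> d dvd G - F \<and> F * G = f * g + d * r}"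
    using set_scan[OF d f r gf] by simp
  have lin: "f \<le> F \<and> 2 * d dvd F - f \<longleftrightarrow> (\<exists>X. F = d * X - a \<and> x \<le> X \<and> even (X - x))" for F
  proof
    assume F: "f \<le> F \<and> 2 * d dvd F - f"
    then obtain i where i: "F - f = 2 * d * i" by blast
    then have "0 \<le> d * i" using F by linarith
    then have "0 \<le> i" using d by (simp add: zero_le_mult_iff)
    then show "\<exists>X. F = d * X - a \<and> x \<le> X \<and> even (X - x)"
      using i by (intro exI[of _ "x + 2 * i"]) (simp add: f_def algebra_simps)
  next
    assume "\<exists>X. F = d * X - a \<and> x \<le> X \<and> even (X - x)"
    then obtain X i where "F = d * X - a" "x \<le> X" "X - x = 2 * i" by blast
    moreover from this have "F - f = 2 * d * i" by (simp add: f_def algebra_simps flip: right_diff_distrib)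
    ultimately show "f \<le> F \<and> 2 * d dvd F - f" using d by (simp add: f_def mult_left_mono)
  qed
  have unfolded: "last_pairs a b lo = map (\<lambda>(F, G). [(F + a) div d, (G + a) div d])
           (filter (\<lambda>(F, G). even ((G + a) div d - lo)) (scan d f g r []))"
    unfolding last_pairs_def Let_def d_def m_def x_def f_def n_def y_def g_def r_def ..
  have mem: "xs \<in> set (last_pairs a b lo) \<longleftrightarrow> (\<exists>F G. xs = [(F + a) div d, (G + a) div d] \<and>
      even ((G + a) div d - lo) \<and> (F, G) \<in> set (scan d f g r []))" for xs
    unfolding unfolded by auto
  have "(\<exists>F G. xs = [(F + a) div d, (G + a) div d] \<and>
      even ((G + a) div d - lo) \<and> (F, G) \<in> set (scan d f g r []))
     \<longleftrightarrow> xs \<in> completions 2 a b lo" (is "?L \<longleftrightarrow> _") for xs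
  proof
    assume ?L
    then obtain F G where FG: "xs = [(F + a) div d, (G + a) div d]" "even ((G + a) div d - lo)"
      "f \<le> F \<and> 2 * d dvd F - f" "F \<le> G" "d dvd G - F" "F * G = f * g + d * r"
      unfolding scan by auto
    obtain X where X: "F = d * X - a" "x \<le> X" "even (X - x)" using FG(3) lin by blast
    obtain i where "G - F = d * i" using FG(5) by blast
    then have Y: "G = d * (X + i) - a" using X by (simp add: algebra_simps)
    have "X \<le> X + i" using FG(4) X Y d by (simp add: algebra_simps zero_le_mult_iff)
    then show "xs \<in> completions 2 a b lo" unfolding split using FG X Y d by auto
  next
    assume "xs \<in> completions 2 a b lo"
    then obtain X Y where XY: "xs = [X, Y]" "x \<le> X" "even (X - x)" "X \<le> Y" "even (Y - lo)"
      "(d * X - a) * (d * Y - a) = f * g + d * r" unfolding split by blast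
    have "d dvd (d * Y - a) - (d * X - a)" by (simp flip: right_diff_distrib)
    moreover have "d * X - a \<le> d * Y - a" using XY d by simp
    ultimately have "(d * X - a, d * Y - a) \<in> set (scan d f g r [])"
      unfolding scan using XY lin[of "d * X - a"] by blast
    then show ?L using XY d by (intro exI[of _ "d * X - a"] exI[of _ "d * Y - a"]) simp
  qed
  then show ?thesis unfolding set_eq_iff mem by blast
qed

section \<open>The search\<close>

text \<open>
  The prefixes that leave two entries open, each with the data \<open>a\<close>, \<open>b\<close>, \<open>lo\<close> of the equation for these
  two. The bound on \<open>x\<close> has \<open>m + 3\<close> because, at stage \<open>Suc m\<close>, the entry \<open>x\<close> is followed by \<open>m\<close> further
  prefix entries and the last two.
\<close>

primrec prefixes :: "nat \<Rightarrow> int \<Rightarrow> int \<Rightarrow> int \<Rightarrow> (int list \<times> int \<times> int \<times> int) list" where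
  "prefixes 0 a b lo = [([], a, b, lo)]"
| "prefixes (Suc m) a b lo =
     concat (map (\<lambda>i. let x = lo + 2 * i; a' = a * (x - 1); b' = b * x
         in if b' < a' then if gcd a' b' = 1
           then map (\<lambda>(xs, p). (x # xs, p)) (prefixes m a' b' x) else [] else [])
       [0..(a * (int m + 3) div (a - b) - lo) div 2])"

definition complete_prefix :: "int list \<times> int \<times> int \<times> int \<Rightarrow> int list list" where
  "complete_prefix = (\<lambda>(xs, a, b, lo). map ((@) xs) (last_pairs a b lo))"

definition extend :: "nat \<Rightarrow> int \<Rightarrow> int \<Rightarrow> int \<Rightarrow> int list list" where
  "extend m a b lo = concat (map complete_prefix (prefixes m a b lo))"

lemma concat_map_concat:
  "concat (map f (concat (map h xs))) = concat (map (\<lambda>x. concat (map f (h x))) xs)"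
  by (induction xs) auto

lemma extend_0: "extend 0 a b lo = last_pairs a b lo"
  by (simp add: extend_def complete_prefix_def map_idI)

lemma extend_Suc:
  "extend (Suc m) a b lo =
     concat (map (\<lambda>i. let x = lo + 2 * i; a' = a * (x - 1); b' = b * x
         in if b' < a' then if gcd a' b' = 1 then map ((#) x) (extend m a' b' x) else [] else [])
       [0..(a * (int m + 3) div (a - b) - lo) div 2])"
proof -
  have "complete_prefix (x # xs, p) = map ((#) x) (complete_prefix (xs, p))" for x xs p
    by (cases p) (simp add: complete_prefix_def)
  then have Cons: "concat (map complete_prefix (map (\<lambda>(xs, p). (x # xs, p)) ps)) =
      map ((#) x) (concat (map complete_prefix ps))" for x ps
    by (induction ps) auto
  show ?thesis unfolding extend_def prefixes.simps concat_map_concat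
    by (intro arg_cong[of _ _ concat] map_cong refl) (simp add: Let_def Cons del: map_map)
qed

lemma set_extend:
  assumes "1 \<le> b" "b < a" "2 \<le> lo"
  shows "set (extend m a b lo) = completions (m + 2) a b lo"
  using assms
proof (induction m arbitrary: a b lo)
  case 0
  then show ?case using set_last_pairs by (simp add: numeral_2_eq_2 extend_0)
next
  case (Suc m)
  let ?B = "(a * (int m + 3) div (a - b) - lo) div 2"
  let ?C = "\<lambda>x. completions (m + 2) (a * (x - 1)) (b * x) x"
  have bx: "1 \<le> b * x" if "lo \<le> x" for x
    using that Suc.prems mult_mono[of 1 b 1 x] by simp
  have "set (extend (Suc m) a b lo) = {x # xs | x xs. lo \<le> x \<and> even (x - lo) \<and> xs \<in> ?C x}"
  proof (intro equalityI subsetI)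
    fix ys assume "ys \<in> set (extend (Suc m) a b lo)"
    then obtain i xs where i: "0 \<le> i" "ys = (lo + 2 * i) # xs" "b * (lo + 2 * i) < a * (lo + 2 * i - 1)"
      "xs \<in> set (extend m (a * (lo + 2 * i - 1)) (b * (lo + 2 * i)) (lo + 2 * i))"
      by (auto simp: extend_Suc Let_def split: if_splits)
    then have "xs \<in> ?C (lo + 2 * i)" using Suc.IH[of "b * (lo + 2 * i)"] bx[of "lo + 2 * i"] Suc.prems by simp
    then show "ys \<in> {x # xs | x xs. lo \<le> x \<and> even (x - lo) \<and> xs \<in> ?C x}"
      using i by auto
  next
    fix ys assume "ys \<in> {x # xs | x xs. lo \<le> x \<and> even (x - lo) \<and> xs \<in> ?C x}"
    then obtain x xs where x: "ys = x # xs" "lo \<le> x" "even (x - lo)" "xs \<in> ?C x" by blast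
    then obtain i where i: "x = lo + 2 * i" by (metis add.commute diff_add_cancel dvd_def)
    have "x # xs \<in> completions (m + 3) a b lo"
      using x Cons_in_completions_iff[of x xs "m + 2"] by (simp add: numeral_3_eq_3 numeral_2_eq_2)
    from completions_hd_bound[OF this] Suc.prems have "x \<le> a * (int m + 3) div (a - b)" by simp
    then have "i \<in> {0..?B}" using i x(2) by simp
    moreover have less: "b * x < a * (x - 1)"
    proof (rule completions_imp_less[OF x(4)])
      have "1 * 2 \<le> (b * x) * int (m + 2)" using bx[OF x(2)] by (intro mult_mono) auto
      then show "1 < b * x * int (m + 2)" by linarith
    qed (use bx x Suc.prems in auto)
    moreover have "gcd (a * (x - 1)) (b * x) = 1" using completions_imp_coprime[OF x(4)] .
    moreover have "xs \<in> set (extend m (a * (x - 1)) (b * x) x)"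
      using Suc.IH[of "b * x"] less bx[OF x(2)] x Suc.prems by simp
    ultimately show "ys \<in> set (extend (Suc m) a b lo)" 
      unfolding x(1) i by (auto simp: extend_Suc Let_def intro!: bexI[of _ i])
  qed
  also have "\<dots> = completions (Suc m + 2) a b lo"
  proof -
    have "ys \<noteq> []" if "ys \<in> completions (Suc m + 2) a b lo" for ys
      using that by (auto simp: completions_def)
    then show ?thesis using Cons_in_completions_iff[of _ _ "m + 2"]
      by (auto simp: neq_Nil_conv) blast+
  qed
  finally show ?case .
qed

text \<open>
  The choices of \<open>k\<close> and of all entries but the last two are listed separately from their completion,
  so that a long evaluation can be divided into independent parts.
\<close>

definition open_cases :: "nat \<Rightarrow> int \<Rightarrow> (int \<times> int list \<times> int \<times> int \<times> int) list" where
  "open_cases r lo =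
     concat (map (\<lambda>k. map (Pair k) (prefixes (r - 2) k 1 lo)) [2..lo ^ r div (lo - 1) ^ r])"

definition complete_case :: "int \<times> int list \<times> int \<times> int \<times> int \<Rightarrow> (int \<times> int list) list" where
  "complete_case = (\<lambda>(k, p). map (Pair k) (complete_prefix p))"

definition search :: "nat \<Rightarrow> int \<Rightarrow> (int \<times> int list) list" where
  "search r lo = concat (map complete_case (open_cases r lo))"

lemma set_search:
  assumes "2 \<le> r" "2 \<le> lo"
  shows "set (search r lo) = {(k, xs). 0 < k \<and> xs \<in> completions r k 1 lo}"
proof -
  have "2 \<le> k \<and> k \<le> lo ^ r div (lo - 1) ^ r" if "0 < k" "xs \<in> completions r k 1 lo" for k xs
    using completions_multiplier_bound[OF that(2)] completions_imp_less[OF that(2)] that assms by simp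
  moreover have "set (extend (r - 2) k 1 lo) = completions r k 1 lo" if "2 \<le> k" for k
    using that assms set_extend[of 1 k lo "r - 2"] by (simp only: le_add_diff_inverse2)
  moreover have "set (search r lo) =
      {(k, xs). k \<in> {2..lo ^ r div (lo - 1) ^ r} \<and> xs \<in> set (extend (r - 2) k 1 lo)}"
  proof -
    have "concat (map complete_case (map (Pair k) ps)) =
        map (Pair k) (concat (map complete_prefix ps))" for k ps
      by (induction ps) (auto simp: complete_case_def)
    then show ?thesis
      unfolding search_def open_cases_def concat_map_concat by (auto simp flip: extend_def)
  qed
  ultimately show ?thesis by auto
qed

section \<open>From sorted lists to multisets\<close>

lemma all_odd_or_all_even:
  fixes xs :: "int list"
  assumes "k * (\<Prod>x\<leftarrow>xs. x - 1) = (\<Prod>x\<leftarrow>xs. x) - 1"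
  shows "(\<forall>x\<in>set xs. odd x) \<or> (\<forall>x\<in>set xs. even x)"
proof (rule disjCI)
  assume "\<not> (\<forall>x\<in>set xs. even x)"
  then obtain x where x: "x \<in> set xs" "odd x" by blast
  have "x - 1 dvd (\<Prod>x\<leftarrow>xs. x - 1)" using x by (intro prod_list_dvd) auto
  then have "even (\<Prod>x\<leftarrow>xs. x - 1)" using dvd_trans[of 2 "x - 1"] x by simp
  then have "odd (\<Prod>x\<leftarrow>xs. x)" using arg_cong[OF assms, of even] by simp
  moreover have "y dvd (\<Prod>x\<leftarrow>xs. x)" if "y \<in> set xs" for y using that by (simp add: prod_list_dvd)
  ultimately show "\<forall>x\<in>set xs. odd x" using dvd_trans by blast
qed

abbreviation forget_order :: "int \<times> int list \<Rightarrow> int \<times> int multiset" where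
  "forget_order \<equiv> map_prod id mset"

lemma solutions_parity_class:
  assumes "2 \<le> r" "2 \<le> lo"
  shows "forget_order ` set (search r lo) = {(k, X) \<in> solutions r. \<forall>x\<in>#X. lo \<le> x \<and> even (x - lo)}"
proof (intro equalityI subsetI)
  fix p assume "p \<in> forget_order ` set (search r lo)"
  then obtain k xs where p: "p = (k, mset xs)" "0 < k" "xs \<in> completions r k 1 lo"
    unfolding set_search[OF assms] by auto
  have "\<forall>x\<in>set xs. lo \<le> x \<and> even (x - lo)" using p(3) by (simp add: completions_def)
  moreover from this have "\<forall>x\<in>set xs. 2 \<le> x" using assms(2) by force
  ultimately show "p \<in> {(k, X) \<in> solutions r. \<forall>x\<in>#X. lo \<le> x \<and> even (x - lo)}"
    using p by (simp add: completions_def solutions_def prod_mset_prod_list flip: mset_map)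
next
  fix p assume "p \<in> {(k, X) \<in> solutions r. \<forall>x\<in>#X. lo \<le> x \<and> even (x - lo)}"
  then obtain k X where p: "p = (k, X)" "(k, X) \<in> solutions r" "\<forall>x\<in>#X. lo \<le> x \<and> even (x - lo)" by blast
  define xs where "xs = sorted_list_of_multiset X"
  have X: "X = mset xs" by (simp add: xs_def)
  have "sorted xs" by (simp add: xs_def)
  then have "(k, xs) \<in> set (search r lo)"
    using p unfolding set_search[OF assms] completions_def solutions_def X
    by (simp add: prod_mset_prod_list flip: mset_map)
  then show "p \<in> forget_order ` set (search r lo)"
    by (rule rev_image_eqI) (simp add: p X)
qed

lemma inj_on_forget_order: "inj_on forget_order (\<Union>r\<in>{2..6}. set (search r lo))" if "2 \<le> lo" for lo
proof (rule inj_onI)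
  fix p q assume "p \<in> (\<Union>r\<in>{2..6}. set (search r lo))" "q \<in> (\<Union>r\<in>{2..6}. set (search r lo))"
    and eq: "forget_order p = forget_order q"
  then have "sorted (snd p)" "sorted (snd q)" using that by (auto simp: set_search completions_def)
  moreover have "mset (snd p) = mset (snd q)" "fst p = fst q" using eq by (cases p; cases q; simp)+
  ultimately show "p = q" by (metis prod_eqI properties_for_sort)
qed

section \<open>The solutions\<close>

lemma search_even:
  shows "search 2 2 =
   [(3, [2, 2])]"
    and "search 3 2 =
   [(3, [2, 4, 8]),
    (5, [2, 2, 4]),
    (7, [2, 2, 2])]"
    and "search 4 2 =
   [(3, [2, 4, 10, 80]),
    (5, [2, 2, 6, 24]),
    (7, [2, 2, 4, 4]),
    (9, [2, 2, 2, 8]),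
    (15, [2, 2, 2, 2])]"
    and "search 5 2 =
   [(3, [2, 4, 10, 112, 290]),
    (3, [2, 4, 10, 100, 422]),
    (3, [2, 4, 10, 92, 670]),
    (3, [2, 4, 10, 82, 6560]),
    (5, [2, 2, 6, 26, 624]),
    (5, [2, 2, 8, 12, 384]),
    (9, [2, 2, 2, 10, 80]),
    (11, [2, 2, 2, 4, 32]),
    (17, [2, 2, 2, 2, 16]),
    (19, [2, 2, 2, 2, 6]),
    (21, [2, 2, 2, 2, 4]),
    (31, [2, 2, 2, 2, 2])]"
    and "search 6 2 =
   [(3, [2, 4, 10, 82, 12440, 13882]),
    (3, [2, 4, 10, 82, 6562, 43046720]),
    (3, [2, 4, 10, 88, 1120, 9944]),
    (3, [2, 4, 26, 26, 26, 8272]),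
    (3, [2, 8, 8, 8, 206, 210944]),
    (5, [2, 2, 6, 26, 626, 390624]),
    (5, [2, 2, 6, 42, 62, 2156]),
    (5, [2, 2, 8, 12, 636, 974]),
    (5, [2, 2, 8, 12, 416, 5154]),
    (5, [2, 2, 8, 12, 404, 8166]),
    (5, [2, 2, 8, 12, 386, 148224]),
    (5, [2, 2, 12, 14, 18, 206]),
    (9, [2, 2, 2, 10, 112, 290]),
    (9, [2, 2, 2, 10, 100, 422]),
    (9, [2, 2, 2, 10, 92, 670]),
    (9, [2, 2, 2, 10, 82, 6560]),
    (11, [2, 2, 2, 4, 38, 244]),
    (11, [2, 2, 2, 4, 34, 1088]),
    (11, [2, 2, 2, 6, 8, 384]),
    (13, [2, 2, 2, 4, 8, 16]),
    (17, [2, 2, 2, 2, 18, 288]),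
    (23, [2, 2, 2, 2, 6, 6]),
    (33, [2, 2, 2, 2, 2, 32]),
    (63, [2, 2, 2, 2, 2, 2])]"
  by code_simp+

lemma search_odd_upto_5:
  shows "search 2 3 =
   [(2, [3, 3])]"
    and "search 3 3 =
   [(2, [3, 5, 15])]"
    and "search 4 3 =
   [(2, [3, 5, 17, 255]),
    (5, [3, 3, 3, 3])]"
    and "search 5 3 =
   [(2, [3, 5, 17, 285, 2507]),
    (2, [3, 5, 17, 257, 65535]),
    (2, [5, 5, 5, 43, 5375]),
    (2, [5, 5, 9, 9, 89])]"
  by code_simp+

text \<open>
  Evaluating six odd entries takes far longer than all other cases together. The work is divided
  evenly: the first five prefixes, which begin with \<open>3, 5, 17\<close> and have \<open>a - b \<le> 19\<close>, involve almost as
  many candidate factors as the several hundred others.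
\<close>

lemma search_odd_6_first:
  "concat (map complete_case (take 5 (open_cases 6 3))) =
   [(2, [3, 5, 17, 257, 68975, 1314417]),
    (2, [3, 5, 17, 257, 65717, 23794275]),
    (2, [3, 5, 17, 257, 65555, 226112997]),
    (2, [3, 5, 17, 257, 65537, 4294967295])]"
  by code_simp

lemma search_odd_6_rest:
  "concat (map complete_case (drop 5 (open_cases 6 3))) =
   [(2, [3, 5, 17, 353, 929, 83623935]),
    (2, [3, 5, 17, 377, 1217, 2295]),
    (2, [3, 5, 17, 395, 1059, 2303]),
    (2, [3, 5, 33, 53, 69, 8343]),
    (2, [3, 9, 9, 23, 131, 732159]),
    (2, [5, 5, 5, 43, 8507, 14605]),
    (2, [5, 5, 5, 43, 6487, 31385]),
    (2, [5, 5, 5, 43, 6215, 39817]),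
    (2, [5, 5, 5, 43, 5717, 90115]),
    (2, [5, 5, 5, 43, 5477, 291475]),
    (2, [5, 5, 5, 43, 5407, 937505]),
    (2, [5, 5, 5, 43, 5387, 2632285]),
    (2, [5, 5, 5, 43, 5377, 28901375]),
    (2, [5, 5, 5, 45, 807, 267023]),
    (2, [5, 5, 5, 47, 457, 50659]),
    (2, [5, 5, 5, 47, 453, 2661375]),
    (2, [5, 5, 5, 65, 129, 2325]),
    (2, [5, 7, 7, 7, 133, 228095]),
    (4, [3, 3, 5, 5, 9, 89])]"
  by code_simp

lemma search_odd_6:
  "search 6 3 =
   [(2, [3, 5, 17, 257, 68975, 1314417]),
    (2, [3, 5, 17, 257, 65717, 23794275]),
    (2, [3, 5, 17, 257, 65555, 226112997]),
    (2, [3, 5, 17, 257, 65537, 4294967295]),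
    (2, [3, 5, 17, 353, 929, 83623935]),
    (2, [3, 5, 17, 377, 1217, 2295]),
    (2, [3, 5, 17, 395, 1059, 2303]),
    (2, [3, 5, 33, 53, 69, 8343]),
    (2, [3, 9, 9, 23, 131, 732159]),
    (2, [5, 5, 5, 43, 8507, 14605]),
    (2, [5, 5, 5, 43, 6487, 31385]),
    (2, [5, 5, 5, 43, 6215, 39817]),
    (2, [5, 5, 5, 43, 5717, 90115]),
    (2, [5, 5, 5, 43, 5477, 291475]),
    (2, [5, 5, 5, 43, 5407, 937505]),
    (2, [5, 5, 5, 43, 5387, 2632285]),
    (2, [5, 5, 5, 43, 5377, 28901375]),
    (2, [5, 5, 5, 45, 807, 267023]),
    (2, [5, 5, 5, 47, 457, 50659]),
    (2, [5, 5, 5, 47, 453, 2661375]),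
    (2, [5, 5, 5, 65, 129, 2325]),
    (2, [5, 7, 7, 7, 133, 228095]),
    (4, [3, 3, 5, 5, 9, 89])]"
proof -
  have "search 6 3 = concat (map complete_case (take 5 (open_cases 6 3))) @
      concat (map complete_case (drop 5 (open_cases 6 3)))"
    unfolding search_def by (simp only: append_take_drop_id flip: concat_append map_append)
  then show ?thesis unfolding search_odd_6_first search_odd_6_rest by simp
qed

lemma card_search:
  shows "card (\<Union>r\<in>{2..6}. set (search r 2)) = 45"
    and "card (\<Union>r\<in>{2..6}. set (search r 3)) = 31"
proof -
  have range: "{2..6} = {2, 3, 4, 5, 6 :: nat}" by auto
  have union: "(\<Union>r\<in>{2..6}. set (search r lo)) =
      set (search 2 lo @ search 3 lo @ search 4 lo @ search 5 lo @ search 6 lo)" for lo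
    unfolding range by auto
  show "card (\<Union>r\<in>{2..6}. set (search r 2)) = 45"
    unfolding union search_even append.simps by (subst distinct_card; code_simp)
  show "card (\<Union>r\<in>{2..6}. set (search r 3)) = 31"
    unfolding union search_odd_upto_5 search_odd_6 append.simps by (subst distinct_card; code_simp)
qed

theorem theorem1p2:
  shows "finite (\<Union>r\<in>{2..6}. solutions r) \<and>
    card (\<Union>r\<in>{2..6}. solutions r) = 76 \<and>
    card {(k, X) \<in> (\<Union>r\<in>{2..6}. solutions r). \<forall>x\<in>#X. odd x \<and> x \<ge> 3} = 31 \<and>
    card {(k, X) \<in> (\<Union>r\<in>{2..6}. solutions r). \<forall>x\<in>#X. even x \<and> x \<ge> 2} = 45"
proof -
  let ?S = "\<Union>r\<in>{2..6}. solutions r"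
  let ?T = "\<lambda>lo. forget_order ` (\<Union>r\<in>{2..6}. set (search r lo))"
  let ?O = "{(k, X) \<in> ?S. \<forall>x\<in>#X. odd x \<and> x \<ge> 3}"
  let ?E = "{(k, X) \<in> ?S. \<forall>x\<in>#X. even x \<and> x \<ge> 2}"
  have T: "?T lo = {(k, X) \<in> ?S. \<forall>x\<in>#X. lo \<le> x \<and> even (x - lo)}" if "2 \<le> lo" for lo
  proof -
    have "?T lo = (\<Union>r\<in>{2..6}. {(k, X) \<in> solutions r. \<forall>x\<in>#X. lo \<le> x \<and> even (x - lo)})"
      unfolding image_UN by (rule SUP_cong) (use that in \<open>simp_all add: solutions_parity_class\<close>)
    also have "\<dots> = {(k, X) \<in> ?S. \<forall>x\<in>#X. lo \<le> x \<and> even (x - lo)}" by auto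
    finally show ?thesis .
  qed
  have O: "?O = ?T 3" using T[of 3] by (simp add: conj_commute )
  have E: "?E = ?T 2" using T[of 2] by (simp add: conj_commute )
  have card_T: "card (?T lo) = card (\<Union>r\<in>{2..6}. set (search r lo))" if "2 \<le> lo" for lo
    using card_image[OF inj_on_forget_order[OF that]] .
  have card_O: "card ?O = 31" unfolding O by (simp add: card_T card_search)
  have card_E: "card ?E = 45" unfolding E by (simp add: card_T card_search)
  have fin: "finite ?O" "finite ?E" unfolding O E by auto
  have S: "?S = ?O \<union> ?E"
  proof (intro equalityI subsetI)
    fix p assume p: "p \<in> ?S"
    then obtain k X r where kX: "p = (k, X)" "(k, X) \<in> solutions r" by (cases p) auto
    obtain xs where X: "X = mset xs" using ex_mset by metis
    have ge2: "\<forall>x\<in>#X. 2 \<le> x" and eq: "k * (\<Prod>x\<leftarrow>xs. x - 1) = (\<Prod>x\<leftarrow>xs. x) - 1"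
      using kX by (auto simp: solutions_def X prod_mset_prod_list simp flip: mset_map)
    have "(\<forall>x\<in>#X. odd x) \<or> (\<forall>x\<in>#X. even x)" using all_odd_or_all_even[OF eq] by (simp add: X)
    moreover have "3 \<le> x" if "odd x" "2 \<le> x" for x :: int using that by (cases "x = 2") auto
    ultimately show "p \<in> ?O \<union> ?E" using p kX ge2 by auto
  qed auto
  have disjoint: "?O \<inter> ?E = {}"
  proof -
    have "\<exists>x. x \<in># X" if "(k, X) \<in> ?S" for k X
    proof -
      have "X \<noteq> {#}" using that by (auto simp: solutions_def)
      then show ?thesis by (meson multiset_nonemptyE)
    qed
    then show ?thesis by blast
  qed
  have "finite ?S" by (subst S) (use fin in blast)
  moreover have "card ?S = 76"
    using card_Un_disjoint[OF fin disjoint] unfolding S[symmetric] card_O card_E by simp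
  ultimately show ?thesis using card_O card_E by blast
qed

end
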